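(* Let $\gamma(t)$, $t\in\mathbb{R}$, be a 1-parameter subgroup of $\mathrm{SL}(2,\mathbb{C})$ with $\gamma'(0)\in H_0$ such that the 1-parameter subgroup $e^{t/2}\gamma(t)$, $t\in\mathbb{R}$, of $\mathrm{GL}^+(2,\mathbb{C})$ is future directed nonspacelike. Then each segment of $e^{t/2}\gamma(t)$, $t\in\mathbb{R}$, is a longest arc in $(\mathrm{GL}^+(2,\mathbb{C}),d)$, parametrized proportionally to the arclength if the 1-parameter subgroup is timelike.
   Context: $\mathrm{GL}^+(2,\mathbb{C})$ is the Lie group of complex $2\times2$ matrices with positive real determinant. Let $e_0=\frac12 I$, $e_1=\frac12\begin{pmatrix}0&1\\1&0\end{pmatrix}$, $e_2=\frac12\begin{pmatrix}0&\mathbf{i}\\-\mathbf{i}&0\end{pmatrix}$, $e_3=\frac12\begin{pmatrix}1&0\\0&-1\end{pmatrix}$. $H=\mathrm{span}_{\mathbb{R}}(e_0,\dots,e_3)$ is the space of Hermitian matrices, with pseudoscalar product $\langle\cdot,\cdot\rangle$ whose quadratic form is $\langle h,h\rangle=h_0^2-h_1^2-h_2^2-h_3^2=4\det h$ for $h=\sum h_ie_i$; $H_0=\mathrm{span}_{\mathbb{R}}(e_1,e_2,e_3)$. $l_g:h\mapsto gh$ is the left shift. A horizontal curve is a Lipschitzian curve with $g'(t)=dl_{g(t)}(u(t))$, $u(t)\in H$ for almost all $t$; it is timelike (nonspacelike) if $\langle u(t),u(t)\rangle>0$ ($\ge0$) and future directed if $\langle u(t),e_0\rangle>0$ for almost all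 $t$. $d(x,y)$ is the supremum of lengths $\int\sqrt{\langle u,u\rangle}\,dt$ of future directed nonspacelike horizontal curves from $x$ to $y$ ($-\infty$ if there are none); a longest arc is a future directed nonspacelike horizontal curve realizing this supremum between its endpoints. *)

theory Defs
  imports "HOL-Analysis.Analysis"
begin

type_synonym cmat2 = "complex^2^2"

definition GLp :: "cmat2 set" where
  "GLp = {A. Im (det A) = 0 \<and> Re (det A) > 0}"

definition SL2C :: "cmat2 set" where
  "SL2C = {A. det A = 1}"

definition e0 :: cmat2 where
  "e0 = (1/2) *\<^sub>R mat 1"

definition e1 :: cmat2 where
  "e1 = (1/2) *\<^sub>R vector [vector [0, 1], vector [1, 0]]"

definition e2 :: cmat2 where
  "e2 = (1/2) *\<^sub>R vector [vector [0, \<i>], vector [- \<i>, 0]]"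

definition e3 :: cmat2 where
  "e3 = (1/2) *\<^sub>R vector [vector [1, 0], vector [0, - 1]]"

definition H :: "cmat2 set" where
  "H = span {e0, e1, e2, e3}"

definition H0 :: "cmat2 set" where
  "H0 = span {e1, e2, e3}"

text \<open>The matrices \<open>e0, e1, e2, e3\<close> are orthogonal with square norm \<open>1/2\<close> for the
  Euclidean inner product of the real vector space of complex matrices, so for \<open>h\<close> in \<open>H\<close>
  the coordinate of \<open>h\<close> along \<open>e\<close> is \<open>2 * (h \<bullet> e)\<close>; see \<open>coord_combination\<close>.\<close>

definition coord :: "cmat2 \<Rightarrow> cmat2 \<Rightarrow> real" where
  "coord e h = 2 * (h \<bullet> e)"

definition pprod :: "cmat2 \<Rightarrow> cmat2 \<Rightarrow> real" where
  "pprod h k = coord e0 h * coord e0 k - coord e1 h * coord e1 k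
             - coord e2 h * coord e2 k - coord e3 h * coord e3 k"

lemma coord_combination:
  fixes a0 a1 a2 a3 :: real
  defines "h \<equiv> a0 *\<^sub>R e0 + a1 *\<^sub>R e1 + a2 *\<^sub>R e2 + a3 *\<^sub>R e3"
  shows "coord e0 h = a0" "coord e1 h = a1" "coord e2 h = a2" "coord e3 h = a3"
  unfolding h_def coord_def e0_def e1_def e2_def e3_def
  by (simp_all add: inner_vec_def sum_2 mat_def inner_complex_def field_simps)

lemma H_iff:
  "h \<in> H \<longleftrightarrow> (\<exists>a0 a1 a2 a3. h = a0 *\<^sub>R e0 + a1 *\<^sub>R e1 + a2 *\<^sub>R e2 + a3 *\<^sub>R e3)"
  unfolding H_def
  by (simp add: span_insert algebra_simps)

lemma pprod_self_eq_det:
  assumes "h \<in> H"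
  shows "complex_of_real (pprod h h) = 4 * det h"
proof -
  obtain a0 a1 a2 a3 where h: "h = a0 *\<^sub>R e0 + a1 *\<^sub>R e1 + a2 *\<^sub>R e2 + a3 *\<^sub>R e3"
    using assms H_iff by blast
  show ?thesis
    unfolding pprod_def h coord_combination det_2
    by (simp add: e0_def e1_def e2_def e3_def mat_def complex_eq_iff field_simps)
qed

text \<open>The differential of the left shift \<open>\<lambda>h. g ** h\<close> is again \<open>\<lambda>h. g ** h\<close>, so the
  \<open>u t\<close> with \<open>g' t = dl (u t)\<close> is determined by \<open>g\<close> wherever \<open>g\<close> is differentiable.\<close>

definition left_velocity :: "(real \<Rightarrow> cmat2) \<Rightarrow> real \<Rightarrow> cmat2" where
  "left_velocity g t = matrix_inv (g t) ** vector_derivative g (at t)"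

lemma left_velocity_eq:
  assumes "(g has_vector_derivative g t ** u) (at t)" and "g t \<in> GLp"
  shows "left_velocity g t = u"
proof -
  have "det (g t) \<noteq> 0"
    using assms(2) by (auto simp: GLp_def)
  then have "\<exists>A'. g t ** A' = mat 1 \<and> A' ** g t = mat 1"
    by (simp add: invertible_det_nz flip: invertible_def)
  then have "matrix_inv (g t) ** g t = mat 1"
    unfolding matrix_inv_def by (rule someI2_ex) simp
  then have "matrix_inv (g t) ** (g t ** u) = u"
    by (simp add: matrix_mul_assoc)
  then show ?thesis
    using vector_derivative_at[OF assms(1)] by (simp add: left_velocity_def)
qed

text \<open>On a compact interval the image of a continuous curve in \<open>GLp\<close> is compact, and there any
  Riemannian metric on \<open>GLp\<close> is comparable with the ambient norm; so the Lipschitz condition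
  may be stated for the latter.\<close>

definition horizontal_curve :: "real \<Rightarrow> real \<Rightarrow> (real \<Rightarrow> cmat2) \<Rightarrow> bool" where
  "horizontal_curve a b g \<longleftrightarrow>
     a < b \<and> g ` {a..b} \<subseteq> GLp \<and> (\<exists>L. L-lipschitz_on {a..b} g) \<and>
     (AE t in lebesgue. t \<in> {a..b} \<longrightarrow>
        (g has_vector_derivative g t ** left_velocity g t) (at t) \<and> left_velocity g t \<in> H)"

definition timelike :: "real \<Rightarrow> real \<Rightarrow> (real \<Rightarrow> cmat2) \<Rightarrow> bool" where
  "timelike a b g \<longleftrightarrow> horizontal_curve a b g \<and>
     (AE t in lebesgue. t \<in> {a..b} \<longrightarrow> pprod (left_velocity g t) (left_velocity g t) > 0)"

definition nonspacelike :: "real \<Rightarrow> real \<Rightarrow> (real \<Rightarrow> cmat2) \<Rightarrow> bool" where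
  "nonspacelike a b g \<longleftrightarrow> horizontal_curve a b g \<and>
     (AE t in lebesgue. t \<in> {a..b} \<longrightarrow> pprod (left_velocity g t) (left_velocity g t) \<ge> 0)"

definition future_directed :: "real \<Rightarrow> real \<Rightarrow> (real \<Rightarrow> cmat2) \<Rightarrow> bool" where
  "future_directed a b g \<longleftrightarrow> horizontal_curve a b g \<and>
     (AE t in lebesgue. t \<in> {a..b} \<longrightarrow> pprod (left_velocity g t) e0 > 0)"

definition curve_length :: "real \<Rightarrow> real \<Rightarrow> (real \<Rightarrow> cmat2) \<Rightarrow> real" where
  "curve_length a b g =
     (LINT t:{a..b}|lebesgue. sqrt (pprod (left_velocity g t) (left_velocity g t)))"

text \<open>In \<open>ereal\<close> the supremum of the empty set is \<open>-\<infinity>\<close>.\<close>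

definition lorentz_dist :: "cmat2 \<Rightarrow> cmat2 \<Rightarrow> ereal" where
  "lorentz_dist x y =
     Sup {ereal (curve_length a b g) | a b g.
            future_directed a b g \<and> nonspacelike a b g \<and> g a = x \<and> g b = y}"

definition longest_arc :: "real \<Rightarrow> real \<Rightarrow> (real \<Rightarrow> cmat2) \<Rightarrow> bool" where
  "longest_arc a b g \<longleftrightarrow> future_directed a b g \<and> nonspacelike a b g \<and>
     ereal (curve_length a b g) = lorentz_dist (g a) (g b)"

definition proportional_to_arclength :: "real \<Rightarrow> real \<Rightarrow> (real \<Rightarrow> cmat2) \<Rightarrow> bool" where
  "proportional_to_arclength a b g \<longleftrightarrow>
     (\<exists>c>0. \<forall>s t. a \<le> s \<and> s \<le> t \<and> t \<le> b \<longrightarrow> curve_length s t g = c * (t - s))"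

definition one_parameter_subgroup :: "cmat2 set \<Rightarrow> (real \<Rightarrow> cmat2) \<Rightarrow> bool" where
  "one_parameter_subgroup G \<gamma> \<longleftrightarrow>
     range \<gamma> \<subseteq> G \<and> continuous_on UNIV \<gamma> \<and> (\<forall>s t. \<gamma> (s + t) = \<gamma> s ** \<gamma> t)"

end

theory Submission
  imports Defs
begin

text \<open>
The upper bound on the length of a competitor comes from a calibration. Write \<open>v\<close> for the
velocity of \<open>\<gamma>\<close>, \<open>r\<close> for its Euclidean length \<open>sqrt (- pprod v v)\<close>, so that the curve
\<open>\<sigma> t = exp (t / 2) *\<^sub>R \<gamma> t\<close> has constant velocity \<open>e0 + v\<close> of square \<open>1 - r\<^sup>2\<close>, and
the segment of \<open>\<sigma>\<close> over \<open>{a..b}\<close> has length \<open>sqrt (1 - r\<^sup>2) * (b - a)\<close>. Two quantities are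
controlled along an arbitrary horizontal curve \<open>g\<close> with velocity \<open>u = u0 *\<^sub>R e0 + w\<close>, where
\<open>w \<in> H0\<close> has Euclidean length \<open>s\<close>:

\<^item> \<open>ln (det g)\<close> has derivative \<open>trace u = u0\<close>;

\<^item> for a fixed row vector \<open>x\<close> and \<open>y = x v* g\<close>, the function \<open>ln (y \<bullet> y)\<close> has derivative
  \<open>2 * (y \<bullet> (y v* u)) / (y \<bullet> y)\<close>, which is at most \<open>u0 + s\<close> because the eigenvalues of the
  Hermitian matrix \<open>u\<close> are \<open>(u0 \<plusminus> s) / 2\<close>.

If \<open>(A, B)\<close> is a point of the unit hyperbola \<open>A\<^sup>2 - B\<^sup>2 = 1\<close> with \<open>A > 0\<close> and \<open>B \<ge> 0\<close>, the
reversed Cauchy--Schwarz inequality gives \<open>sqrt (u0\<^sup>2 - s\<^sup>2) \<le> A * u0 - B * s\<close>. Hence the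
function \<open>(A + B) * ln (det g) - B * ln (y \<bullet> y)\<close> grows at least as fast as the arclength
(\<open>pprod_calibration\<close>), and its increment bounds the length of \<open>g\<close> in terms of the end points
(\<open>curve_length_le\<close>).

It remains to choose \<open>x\<close>, \<open>A\<close> and \<open>B\<close> so that the bound is sharp for \<open>\<sigma>\<close>. For \<open>x\<close> take a row
eigenvector of \<open>v\<close> for the eigenvalue \<open>r / 2\<close>; then \<open>x v* \<sigma> t = exp ((1 + r) * t / 2) *\<^sub>R x\<close>, and
every competitor from \<open>\<sigma> a\<close> to \<open>\<sigma> b\<close> has length at most \<open>(A - B * r) * (b - a)\<close>. If
\<open>r < 1\<close>, then \<open>A = 1 / sqrt (1 - r\<^sup>2)\<close> and \<open>B = r * A\<close> give the length of \<open>\<sigma>\<close>. If \<open>r = 1\<close>,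
the subgroup is null, and \<open>A = cosh \<theta>\<close>, \<open>B = sinh \<theta>\<close> give \<open>exp (- \<theta>) * (b - a)\<close>, which tends
to \<open>0\<close>, the length of \<open>\<sigma>\<close>.
\<close>

section \<open>Integrals and increments of Lipschitz functions\<close>

text \<open>This is one half of the fundamental theorem of calculus for Lipschitz functions. The difference
quotients of \<open>F\<close> with steps tending to \<open>0\<close> are bounded by the Lipschitz constant and converge almost
everywhere to the derivative, so by dominated convergence their integrals converge to its integral.
On the other hand, these integrals are difference quotients at \<open>b\<close> and \<open>a\<close> of an antiderivative
of the continuous function \<open>F\<close>, so they converge to \<open>F b - F a\<close>.
The requirement \<open>0 \<le> D\<close> covers the case that \<open>f\<close> is not integrable, when its integral is \<open>0\<close> by
convention.\<close>

lemma lipschitz_integral_le_increment: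
  fixes F f :: "real \<Rightarrow> real"
  assumes "a < b" and lip: "L-lipschitz_on {a..b} F"
    and deriv: "AE t in lebesgue. t \<in> {a..b} \<longrightarrow>
          (\<exists>D. (F has_real_derivative D) (at t) \<and> f t \<le> D \<and> 0 \<le> D)"
  shows "(LINT t:{a..b}|lebesgue. f t) \<le> F b - F a"
proof -
  \<comment> \<open>Extending \<open>F\<close> by constants makes the difference quotients meaningful up to \<open>b\<close>.\<close>
  define G where "G t = F (max a (min b t))" for t
  define h where "h n = 1 / real (Suc n)" for n
  define Q where "Q n t = (G (t + h n) - G t) / h n" for n t
  \<comment> \<open>A Borel function that agrees almost everywhere on the interval with the derivative.\<close>
  define q where "q t = lim (\<lambda>n. Q n t)" for t
  have h_pos: "h n > 0" and h_le: "h n \<le> 1" for n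
    by (auto simp: h_def)
  have h_lim: "h \<longlonglongrightarrow> 0"
    unfolding h_def by (rule LIMSEQ_Suc[OF lim_1_over_n])
  have "L \<ge> 0" using lip by (rule lipschitz_on_nonneg)
  have G_lip: "L-lipschitz_on UNIV G"
  proof (rule lipschitz_onI[OF _ \<open>L \<ge> 0\<close>])
    fix s t :: real
    have "dist (G s) (G t) \<le> L * dist (max a (min b s)) (max a (min b t))"
      unfolding G_def using lip \<open>a < b\<close> by (intro lipschitz_onD) auto
    also have "\<dots> \<le> L * dist s t"
      using \<open>L \<ge> 0\<close> by (intro mult_left_mono) (auto simp: dist_real_def)
    finally show "dist (G s) (G t) \<le> L * dist s t" .
  qed
  have G_cont: "continuous_on UNIV G"
    using G_lip by (rule lipschitz_on_continuous_on)
  have Q_cont: "continuous_on UNIV (Q n)" for n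
    unfolding Q_def using h_pos[of n]
    by (intro continuous_intros continuous_on_compose2[OF G_cont]) auto
  have Q_meas[measurable]: "Q n \<in> borel_measurable borel" for n
    by (rule borel_measurable_continuous_onI[OF Q_cont])
  have q_meas: "q \<in> borel_measurable borel"
    unfolding q_def by measurable
  have Q_bound: "\<bar>Q n t\<bar> \<le> L" for n t
  proof -
    have "dist (G (t + h n)) (G t) \<le> L * dist (t + h n) t"
      using G_lip by (rule lipschitz_onD) auto
    then show ?thesis
      using h_pos[of n] by (simp add: Q_def dist_real_def divide_le_eq)
  qed
  have Q_tendsto: "(\<lambda>n. Q n t) \<longlonglongrightarrow> D"
    if t: "a < t" "t < b" and D: "(F has_real_derivative D) (at t)" for t D
  proof -
    have "(G has_real_derivative D) (at t)"
    proof (rule DERIV_cong_ev[THEN iffD2, OF refl _ refl D])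
      have "\<forall>\<^sub>F s in nhds t. s \<in> {a<..<b}"
        using t by (intro eventually_nhds_in_open) auto
      then show "\<forall>\<^sub>F s in nhds t. G s = F s"
        by eventually_elim (auto simp: G_def min_def max_def)
    qed
    then have "((\<lambda>k. (G (t + k) - G t) / k) \<longlongrightarrow> D) (at 0)"
      by (simp add: DERIV_def)
    moreover have "filterlim h (at 0) sequentially"
      using h_lim h_pos by (auto simp: filterlim_at less_imp_neq[symmetric])
    ultimately show ?thesis
      unfolding Q_def by (rule filterlim_compose)
  qed
  have not_endpoint: "AE t in lebesgue. t \<noteq> a \<and> t \<noteq> b"
    using AE_lborel_singleton[of a] AE_lborel_singleton[of b]
    by (intro AE_completion) (auto elim: AE_mp)
  have q_ae: "AE t in lebesgue. t \<in> {a..b} \<longrightarrow>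
                (\<lambda>n. Q n t) \<longlonglongrightarrow> q t \<and> f t \<le> q t \<and> 0 \<le> q t"
    using deriv not_endpoint
  proof eventually_elim
    case (elim t)
    then show ?case
      using Q_tendsto[of t] limI[of "\<lambda>n. Q n t"] by (fastforce simp: q_def)
  qed
  have int_L: "integrable lebesgue (\<lambda>t. indicator {a..b} t * L :: real)"
    by (intro integrable_mult_left) (auto simp: integrable_indicator_iff emeasure_lborel_Icc_eq)
  have Q_ind_meas: "(\<lambda>t. indicator {a..b} t * Q n t) \<in> borel_measurable lebesgue" for n
    by (intro measurable_completion) (simp, measurable)
  have q_ind_meas: "(\<lambda>t. indicator {a..b} t * q t) \<in> borel_measurable lebesgue"
    using q_meas by (intro measurable_completion) (simp)
  have q_lim: "AE t in lebesgue. (\<lambda>n. indicator {a..b} t * Q n t) \<longlonglongrightarrow> indicator {a..b} t * q t"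
    using q_ae by eventually_elim (auto simp: indicator_def)
  have Q_dom: "AE t in lebesgue. norm (indicator {a..b} t * Q n t) \<le> indicator {a..b} t * L" for n
    using Q_bound by (auto simp: indicator_def)
  note dct = q_ind_meas Q_ind_meas int_L q_lim Q_dom
  have q_int: "integrable lebesgue (\<lambda>t. indicator {a..b} t * q t)"
    by (rule integrable_dominated_convergence[OF dct])
  have lim_int: "(\<lambda>n. LINT t|lebesgue. indicator {a..b} t * Q n t)
      \<longlonglongrightarrow> (LINT t|lebesgue. indicator {a..b} t * q t)"
    by (rule integral_dominated_convergence[OF dct])
  obtain P where P: "\<And>x. x \<in> {a-1..b+2} \<Longrightarrow>
      (P has_vector_derivative G x) (at x within {a-1..b+2})"
    using antiderivative_continuous[of "a-1" "b+2" G] G_cont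
    by (meson continuous_on_subset subset_UNIV)
  have P: "(P has_real_derivative G x) (at x)" if "a - 1 < x" "x < b + 2" for x
    using P[of x] that at_within_Icc_at[of "a-1" x "b+2"]
    by (simp add: has_real_derivative_iff_has_vector_derivative)
  have Q_integral: "(LINT t|lebesgue. indicator {a..b} t * Q n t)
      = (P (b + h n) - P b) / h n - (P (a + h n) - P a) / h n" for n
  proof -
    define R where "R t = (P (t + h n) - P t) / h n" for t
    have "(R has_real_derivative Q n t) (at t)" if "t \<in> {a..b}" for t
      unfolding R_def Q_def using that h_pos[of n] h_le[of n]
      by (auto intro!: derivative_eq_intros DERIV_chain'[OF _ P] P)
    then have "(Q n has_integral R b - R a) {a..b}"
      using \<open>a < b\<close>
      by (intro fundamental_theorem_of_calculus)
         (auto simp: has_real_derivative_iff_has_vector_derivative[symmetric]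
               intro: has_field_derivative_at_within)
    then have "integral {a..b} (Q n) = R b - R a"
      by (rule integral_unique)
    moreover have "set_integrable lebesgue {a..b} (Q n)"
      by (intro absolutely_integrable_continuous_real continuous_on_subset[OF Q_cont]) auto
    then have "(LINT t:{a..b}|lebesgue. Q n t) = integral {a..b} (Q n)"
      by (rule set_lebesgue_integral_eq_integral)
    ultimately show ?thesis
      by (simp add: set_lebesgue_integral_def R_def diff_divide_distrib)
  qed
  have P_quot: "(\<lambda>n. (P (x + h n) - P x) / h n) \<longlonglongrightarrow> G x" if "x \<in> {a..b}" for x
  proof -
    have "((\<lambda>k. (P (x + k) - P x) / k) \<longlongrightarrow> G x) (at 0)"
      using P[of x] that by (simp add: DERIV_def)
    moreover have "filterlim h (at 0) sequentially"
      using h_lim h_pos by (auto simp: filterlim_at less_imp_neq[symmetric])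
    ultimately show ?thesis by (rule filterlim_compose)
  qed
  have "(\<lambda>n. LINT t|lebesgue. indicator {a..b} t * Q n t) \<longlonglongrightarrow> G b - G a"
    unfolding Q_integral using \<open>a < b\<close> by (intro tendsto_diff P_quot) auto
  then have q_total: "(LINT t|lebesgue. indicator {a..b} t * q t) = F b - F a"
    using lim_int \<open>a < b\<close> by (auto simp: G_def dest: LIMSEQ_unique)
  have "(LINT t:{a..b}|lebesgue. f t) \<le> (LINT t|lebesgue. indicator {a..b} t * q t)"
    unfolding set_lebesgue_integral_def real_scaleR_def
  proof (rule integral_mono_AE'[OF q_int])
    show "AE t in lebesgue. indicator {a..b} t * f t \<le> indicator {a..b} t * q t"
      using q_ae by eventually_elim (auto simp: indicator_def)
    show "AE t in lebesgue. 0 \<le> indicator {a..b} t * q t"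
      using q_ae by eventually_elim (auto simp: indicator_def)
  qed
  with q_total show ?thesis by simp
qed

section \<open>Products and logarithms of Lipschitz functions\<close>

lemma (in bounded_bilinear) lipschitz_on_prod:
  assumes "compact S" and f: "L-lipschitz_on S f" and g: "M-lipschitz_on S g"
  shows "\<exists>K. K-lipschitz_on S (\<lambda>x. prod (f x) (g x))"
proof -
  obtain C where C: "C > 0" "\<And>a b. norm (prod a b) \<le> norm a * norm b * C"
    using pos_bounded by blast
  obtain Bf where Bf: "Bf > 0" "\<And>x. x \<in> S \<Longrightarrow> norm (f x) \<le> Bf"
    using compact_imp_bounded[OF compact_continuous_image[OF lipschitz_on_continuous_on[OF f] \<open>compact S\<close>]]
    unfolding bounded_pos by auto
  obtain Bg where Bg: "Bg > 0" "\<And>x. x \<in> S \<Longrightarrow> norm (g x) \<le> Bg"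
    using compact_imp_bounded[OF compact_continuous_image[OF lipschitz_on_continuous_on[OF g] \<open>compact S\<close>]]
    unfolding bounded_pos by auto
  note nonneg = lipschitz_on_nonneg[OF f] lipschitz_on_nonneg[OF g]
  have "((L * Bg + Bf * M) * C)-lipschitz_on S (\<lambda>x. prod (f x) (g x))"
  proof (rule lipschitz_onI)
    fix x y assume xy: "x \<in> S" "y \<in> S"
    have "prod (f x) (g x) - prod (f y) (g y) = prod (f x - f y) (g x) + prod (f y) (g x - g y)"
      by (simp add: diff_left diff_right)
    then have "norm (prod (f x) (g x) - prod (f y) (g y))
        \<le> norm (f x - f y) * norm (g x) * C + norm (f y) * norm (g x - g y) * C"
      by (metis C(2) norm_triangle_mono)
    also have "\<dots> \<le> (L * dist x y) * Bg * C + Bf * (M * dist x y) * C"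
      using C(1) Bf(1) Bg(1) Bf(2)[OF xy(2)] Bg(2)[OF xy(1)] nonneg
        lipschitz_onD[OF f xy] lipschitz_onD[OF g xy]
      by (intro add_mono mult_mono mult_nonneg_nonneg) (auto simp: dist_norm)
    finally show "dist (prod (f x) (g x)) (prod (f y) (g y)) \<le> (L * Bg + Bf * M) * C * dist x y"
      by (simp add: dist_norm algebra_simps)
  qed (use nonneg C(1) Bf(1) Bg(1) in auto)
  then show ?thesis by blast
qed

lemma lipschitz_on_ln:
  fixes f :: "'a::metric_space \<Rightarrow> real"
  assumes "compact S" and f: "L-lipschitz_on S f" and pos: "\<And>x. x \<in> S \<Longrightarrow> f x > 0"
  shows "\<exists>K. K-lipschitz_on S (\<lambda>x. ln (f x))"
proof (cases "S = {}")
  case False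
  obtain z where z: "z \<in> S" "\<And>x. x \<in> S \<Longrightarrow> f z \<le> f x"
    using continuous_attains_inf[OF \<open>compact S\<close> False lipschitz_on_continuous_on[OF f]] by blast
  have ln_diff: "ln p - ln q \<le> \<bar>p - q\<bar> / f z" if "q \<ge> f z" "p \<ge> f z" for p q
  proof -
    have "q > 0" "p > 0" using that pos[OF z(1)] by auto
    have "ln p - ln q \<le> (p - q) / q" by (rule ln_diff_le[OF \<open>p > 0\<close> \<open>q > 0\<close>])
    also have "\<dots> \<le> \<bar>p - q\<bar> / f z"
      using that pos[OF z(1)] by (intro frac_le) auto
    finally show ?thesis .
  qed
  have "(L / f z)-lipschitz_on S (\<lambda>x. ln (f x))"
  proof (rule lipschitz_onI)
    fix x y assume xy: "x \<in> S" "y \<in> S"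
    have "dist (ln (f x)) (ln (f y)) \<le> \<bar>f x - f y\<bar> / f z"
      using ln_diff[of "f x" "f y"] ln_diff[of "f y" "f x"] z(2)[OF xy(1)] z(2)[OF xy(2)]
      by (auto simp: dist_real_def abs_le_iff abs_minus_commute)
    also have "\<dots> \<le> L * dist x y / f z"
      using lipschitz_onD[OF f xy] pos[OF z(1)]
      by (intro divide_right_mono) (auto simp: dist_real_def)
    finally show "dist (ln (f x)) (ln (f y)) \<le> L / f z * dist x y" by simp
  qed (use pos[OF z(1)] lipschitz_on_nonneg[OF f] in auto)
  then show ?thesis by blast
qed auto

lemma lipschitz_on_bounded_linear_compose:
  assumes "bounded_linear h" "L-lipschitz_on S f"
  shows "\<exists>K. K-lipschitz_on S (\<lambda>x. h (f x))"
proof -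
  obtain C where "C-lipschitz_on (f ` S) h"
    using bounded_linear.lipschitz_boundE[OF assms(1)] by blast
  with assms(2) show ?thesis
    by (intro exI) (rule lipschitz_on_compose2)
qed

section \<open>Hermitian matrices and the calibrating inequality\<close>

lemma H0_iff:
  "h \<in> H0 \<longleftrightarrow> (\<exists>a1 a2 a3. h = a1 *\<^sub>R e1 + a2 *\<^sub>R e2 + a3 *\<^sub>R e3)"
  unfolding H0_def by (simp add: span_insert algebra_simps)

lemma e_entries:
  "e0 $ 1 $ 1 = 1/2" "e0 $ 1 $ 2 = 0" "e0 $ 2 $ 1 = 0" "e0 $ 2 $ 2 = 1/2"
  "e1 $ 1 $ 1 = 0" "e1 $ 1 $ 2 = 1/2" "e1 $ 2 $ 1 = 1/2" "e1 $ 2 $ 2 = 0"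
  "e2 $ 1 $ 1 = 0" "e2 $ 1 $ 2 = \<i>/2" "e2 $ 2 $ 1 = - \<i>/2" "e2 $ 2 $ 2 = 0"
  "e3 $ 1 $ 1 = 1/2" "e3 $ 1 $ 2 = 0" "e3 $ 2 $ 1 = 0" "e3 $ 2 $ 2 = - 1/2"
  by (simp_all add: e0_def e1_def e2_def e3_def mat_def complex_eq_iff)

lemma coord_e0: "coord e0 e0 = 1" "coord e1 e0 = 0" "coord e2 e0 = 0" "coord e3 e0 = 0"
  using coord_combination[of 1 0 0 0] by simp_all

lemma pprod_e0: "pprod u e0 = coord e0 u"
  by (simp add: pprod_def coord_e0)

text \<open>The last three summands pair the \<open>H0\<close> part of the matrix with the image of \<open>y\<close> under the Hopf map
from \<open>complex^2\<close> to Euclidean 3-space; by \<open>hopf_norm\<close> that image has length \<open>y \<bullet> y\<close>.\<close>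

lemma two_inner_row_mult:
  fixes y :: "complex^2" and a0 a1 a2 a3 :: real
  defines "u \<equiv> a0 *\<^sub>R e0 + a1 *\<^sub>R e1 + a2 *\<^sub>R e2 + a3 *\<^sub>R e3"
  shows "2 * (y \<bullet> (y v* u)) = a0 * (y \<bullet> y)
      + (a1 * (2 * Re (cnj (y$1) * y$2)) + a2 * (2 * Im (cnj (y$1) * y$2))
         + a3 * ((cmod (y$1))\<^sup>2 - (cmod (y$2))\<^sup>2))"
  unfolding u_def cmod_power2
  by (simp add: vector_matrix_mult_def inner_vec_def sum_2 e_entries inner_complex_def
      algebra_simps power2_eq_square)

lemma hopf_norm:
  fixes y :: "complex^2"
  shows "(2 * Re (cnj (y$1) * y$2))\<^sup>2 + (2 * Im (cnj (y$1) * y$2))\<^sup>2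
      + ((cmod (y$1))\<^sup>2 - (cmod (y$2))\<^sup>2)\<^sup>2 = (y \<bullet> y)\<^sup>2"
  unfolding inner_vec_def sum_2 inner_complex_def cmod_power2
  by (simp add: power2_eq_square algebra_simps)

lemma cauchy_schwarz_3:
  fixes a1 a2 a3 b1 b2 b3 :: real
  shows "(a1 * b1 + a2 * b2 + a3 * b3)\<^sup>2 \<le> (a1\<^sup>2 + a2\<^sup>2 + a3\<^sup>2) * (b1\<^sup>2 + b2\<^sup>2 + b3\<^sup>2)"
proof -
  have "(a1\<^sup>2 + a2\<^sup>2 + a3\<^sup>2) * (b1\<^sup>2 + b2\<^sup>2 + b3\<^sup>2) - (a1 * b1 + a2 * b2 + a3 * b3)\<^sup>2
      = (a1 * b2 - a2 * b1)\<^sup>2 + (a1 * b3 - a3 * b1)\<^sup>2 + (a2 * b3 - a3 * b2)\<^sup>2"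
    by (simp add: power2_eq_square algebra_simps)
  also have "\<dots> \<ge> 0" by simp
  finally show ?thesis by linarith
qed

text \<open>The root on the right is the Euclidean length \<open>s\<close> of the \<open>H0\<close> part of \<open>u\<close>, and \<open>coord e0 u + s\<close>
is twice the largest eigenvalue of \<open>u\<close>.\<close>

lemma row_form_le:
  assumes "u \<in> H"
  shows "2 * (y \<bullet> (y v* u)) \<le> (coord e0 u + sqrt ((coord e0 u)\<^sup>2 - pprod u u)) * (y \<bullet> y)"
proof -
  obtain a0 a1 a2 a3 where u: "u = a0 *\<^sub>R e0 + a1 *\<^sub>R e1 + a2 *\<^sub>R e2 + a3 *\<^sub>R e3"
    using assms H_iff by blast
  let ?m1 = "2 * Re (cnj (y$1) * y$2)" and ?m2 = "2 * Im (cnj (y$1) * y$2)"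
  let ?m3 = "(cmod (y$1))\<^sup>2 - (cmod (y$2))\<^sup>2"
  have coords: "coord e0 u = a0" "a0\<^sup>2 - pprod u u = a1\<^sup>2 + a2\<^sup>2 + a3\<^sup>2"
    unfolding pprod_def u coord_combination by (simp_all add: power2_eq_square)
  have "a1 * ?m1 + a2 * ?m2 + a3 * ?m3 \<le> sqrt ((a1\<^sup>2 + a2\<^sup>2 + a3\<^sup>2) * (y \<bullet> y)\<^sup>2)"
    using cauchy_schwarz_3[of a1 ?m1 a2 ?m2 a3 ?m3]
    by (intro real_le_rsqrt) (simp only: hopf_norm)
  also have "\<dots> = sqrt (a1\<^sup>2 + a2\<^sup>2 + a3\<^sup>2) * (y \<bullet> y)"
    by (simp add: real_sqrt_mult)
  finally show ?thesis
    using two_inner_row_mult[of y a0 a1 a2 a3] unfolding coords unfolding u[symmetric]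
    by (simp add: distrib_right)
qed

text \<open>In terms of \<open>c = coord e0 u\<close> and of the Euclidean length \<open>s\<close> of the \<open>H0\<close> part of \<open>u\<close>, the inequality
\<open>sqrt (c\<^sup>2 - s\<^sup>2) \<le> A * c - B * s\<close> holds because the difference of the squares of its two sides is
\<open>(B * c - A * s)\<^sup>2\<close>. The bound on the Hermitian form in \<open>row_form_le\<close> then
eliminates \<open>s\<close>, where \<open>B \<ge> 0\<close> gives the right direction.\<close>

lemma pprod_calibration:
  assumes u: "u \<in> H" "0 \<le> pprod u u" "0 < pprod u e0"
    and AB: "A\<^sup>2 - B\<^sup>2 = 1" "0 < A" "0 \<le> B"
    and "y \<noteq> 0"
  shows "sqrt (pprod u u)
      \<le> (A + B) * coord e0 u - B * (2 * (y \<bullet> (y v* u)) / (y \<bullet> y))"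
proof -
  define c where "c = coord e0 u"
  define s where "s = sqrt (c\<^sup>2 - pprod u u)"
  have "pprod u u \<le> c\<^sup>2"
    using zero_le_square[of "coord e1 u"] zero_le_square[of "coord e2 u"]
      zero_le_square[of "coord e3 u"]
    unfolding pprod_def c_def power2_eq_square by linarith
  then have s: "s\<^sup>2 = c\<^sup>2 - pprod u u" "s \<ge> 0"
    by (simp_all add: s_def)
  have "c > 0" using u(3) by (simp add: pprod_e0 c_def)
  have "s \<le> c"
  proof (rule power2_le_imp_le)
    show "s\<^sup>2 \<le> c\<^sup>2" using s(1) u(2) by linarith
  qed (use \<open>c > 0\<close> in simp)
  have "B \<le> A"
  proof (rule power2_le_imp_le)
    show "B\<^sup>2 \<le> A\<^sup>2" using AB(1) by linarith
  qed (use AB(2) in simp)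
  have "(A * c - B * s)\<^sup>2 - pprod u u = (A * c - B * s)\<^sup>2 - (A\<^sup>2 - B\<^sup>2) * (c\<^sup>2 - s\<^sup>2)"
    using s AB(1) by simp
  also have "\<dots> = (B * c - A * s)\<^sup>2"
    by (simp add: power2_eq_square algebra_simps)
  finally have "pprod u u \<le> (A * c - B * s)\<^sup>2"
    using zero_le_power2[of "B * c - A * s"] by linarith
  moreover have "B * s \<le> A * c"
    using \<open>B \<le> A\<close> \<open>s \<le> c\<close> s(2) AB by (intro mult_mono) auto
  ultimately have "sqrt (pprod u u) \<le> A * c - B * s"
    by (intro real_le_lsqrt) auto
  also have "\<dots> = (A + B) * c - B * (c + s)"
    by (simp add: algebra_simps)
  also have "\<dots> \<le> (A + B) * c - B * (2 * (y \<bullet> (y v* u)) / (y \<bullet> y))"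
    using row_form_le[OF u(1), of y] \<open>y \<noteq> 0\<close> AB(3)
    by (intro diff_left_mono mult_left_mono)
       (simp_all add: c_def s_def divide_le_eq)
  finally show ?thesis by (simp add: c_def)
qed

text \<open>A matrix in \<open>H0\<close> is Hermitian with trace \<open>0\<close> and determinant \<open>pprod v v / 4\<close>, so its eigenvalues are
\<open>\<plusminus> sqrt (- pprod v v) / 2\<close>. The explicit eigenvector below vanishes exactly when the matrix is a nonnegative
multiple of \<open>e3\<close>, and then the first coordinate vector is one.\<close>

lemma H0_row_eigenvector:
  assumes "v \<in> H0"
  obtains x :: "complex^2" where "x \<noteq> 0" "x v* v = (sqrt (- pprod v v) / 2) *\<^sub>R x"
proof -
  obtain a1 a2 a3 where v: "v = a1 *\<^sub>R e1 + a2 *\<^sub>R e2 + a3 *\<^sub>R e3"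
    using assms H0_iff by blast
  define r where "r = sqrt (- pprod v v)"
  have "- pprod v v = a1\<^sup>2 + a2\<^sup>2 + a3\<^sup>2"
    using coord_combination[of 0 a1 a2 a3]
    unfolding pprod_def v by (simp add: power2_eq_square)
  then have r: "r\<^sup>2 = a1\<^sup>2 + a2\<^sup>2 + a3\<^sup>2" "r \<ge> 0"
    by (simp_all add: r_def)
  show thesis
  proof (cases "a1 = 0 \<and> a2 = 0 \<and> a3 \<ge> 0")
    case True
    then have "r = a3" using r by (simp add: power2_eq_iff_nonneg)
    with True have "axis 1 1 v* v = (r / 2) *\<^sub>R (axis 1 1 :: complex^2)"
      by (simp add: vec_eq_iff forall_2 vector_matrix_mult_def sum_2 v e_entries axis_def
          complex_eq_iff)
    then show thesis by (intro that[of "axis 1 1"]) (simp_all add: r_def axis_eq_0_iff)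
  next
    case False
    define x :: "complex^2" where "x = vector [Complex a1 (- a2), of_real (r - a3)]"
    have "x \<noteq> 0"
    proof
      assume "x = 0"
      then have "x $ 1 = 0" "x $ 2 = 0" by simp_all
      then have "a1 = 0" "a2 = 0" "r = a3" by (simp_all add: x_def complex_eq_iff)
      with False r show False by auto
    qed
    moreover have "x v* v = (r / 2) *\<^sub>R x"
      using r(1)
      by (simp add: vec_eq_iff forall_2 vector_matrix_mult_def sum_2 v e_entries x_def
          complex_eq_iff field_simps power2_eq_square)
    ultimately show thesis by (intro that) (simp_all add: r_def)
  qed
qed

lemma pprod_e0_plus_H0:
  assumes "v \<in> H0"
  shows "e0 + v \<in> H" "pprod (e0 + v) (e0 + v) = 1 + pprod v v" "pprod v v \<le> 0"
proof -
  obtain a1 a2 a3 where v: "v = a1 *\<^sub>R e1 + a2 *\<^sub>R e2 + a3 *\<^sub>R e3"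
    using assms H0_iff by blast
  have ev: "e0 + v = 1 *\<^sub>R e0 + a1 *\<^sub>R e1 + a2 *\<^sub>R e2 + a3 *\<^sub>R e3"
    by (simp add: v)
  show "e0 + v \<in> H" using ev H_iff by blast
  have pv: "pprod v v = - (a1\<^sup>2 + a2\<^sup>2 + a3\<^sup>2)"
    using coord_combination[of 0 a1 a2 a3]
    unfolding pprod_def v by (simp add: power2_eq_square)
  then show "pprod v v \<le> 0"
    using zero_le_power2[of a1] zero_le_power2[of a2] zero_le_power2[of a3] by linarith
  show "pprod (e0 + v) (e0 + v) = 1 + pprod v v"
    unfolding pv unfolding pprod_def ev coord_combination by (simp add: power2_eq_square)
qed

section \<open>Matrix multiplication and one-parameter subgroups\<close>

lemma bounded_linear_row_mult: "bounded_linear (\<lambda>A. x v* (A::cmat2))"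
  by (intro linear_conv_bounded_linear[THEN iffD1] linearI)
     (simp_all add: vec_eq_iff vector_matrix_mult_def sum_2 algebra_simps)

lemma bounded_linear_matrix_mult_left: "bounded_linear (\<lambda>A. M ** (A::cmat2))"
  by (intro linear_conv_bounded_linear[THEN iffD1] linearI)
     (simp_all add: vec_eq_iff matrix_matrix_mult_def sum_2 algebra_simps)

lemma bounded_linear_matrix_mult_right: "bounded_linear (\<lambda>A. (A::cmat2) ** M)"
  by (intro linear_conv_bounded_linear[THEN iffD1] linearI)
     (simp_all add: vec_eq_iff matrix_matrix_mult_def sum_2 algebra_simps)

lemma scaleR_row_mult: "(k *\<^sub>R x) v* (A::cmat2) = k *\<^sub>R (x v* A)"
  by (simp add: vec_eq_iff vector_matrix_mult_def sum_2 algebra_simps)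

lemma one_parameter_subgroup_derivative:
  assumes "one_parameter_subgroup G \<gamma>" and v: "(\<gamma> has_vector_derivative v) (at 0)"
  shows "(\<gamma> has_vector_derivative \<gamma> t ** v) (at t)"
    and "(\<gamma> has_vector_derivative v ** \<gamma> t) (at t)"
proof -
  have mult: "\<gamma> (s + t) = \<gamma> s ** \<gamma> t" for s t
    using assms(1) by (simp add: one_parameter_subgroup_def)
  have "((\<lambda>s. s - t) has_vector_derivative 1) (at t)"
    by (auto intro!: derivative_eq_intros simp: has_vector_derivative_def)
  then have shift: "((\<lambda>s. \<gamma> (s - t)) has_vector_derivative v) (at t)"
    using vector_diff_chain_at[of "\<lambda>s. s - t" 1 t \<gamma> v] v
    by (simp add: o_def)
  have "\<gamma> = (\<lambda>s. \<gamma> t ** \<gamma> (s - t))" "\<gamma> = (\<lambda>s. \<gamma> (s - t) ** \<gamma> t)"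
    by (simp_all flip: mult)
  then show "(\<gamma> has_vector_derivative \<gamma> t ** v) (at t)"
    "(\<gamma> has_vector_derivative v ** \<gamma> t) (at t)"
    using bounded_linear.has_vector_derivative[OF bounded_linear_matrix_mult_left shift, of "\<gamma> t"]
      bounded_linear.has_vector_derivative[OF bounded_linear_matrix_mult_right shift, of "\<gamma> t"]
    by simp_all
qed

lemma one_parameter_subgroup_0:
  assumes "one_parameter_subgroup SL2C \<gamma>"
  shows "\<gamma> 0 = mat 1"
proof -
  have "det (\<gamma> 0) = 1" and idem: "\<gamma> 0 ** \<gamma> 0 = \<gamma> 0"
    using assms by (auto simp: one_parameter_subgroup_def SL2C_def image_subset_iff)
      (metis add_0)
  then have "invertible (\<gamma> 0)" by (simp add: invertible_det_nz)
  then obtain A where "A ** \<gamma> 0 = mat 1" by (auto simp: invertible_def)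
  then show ?thesis
    by (metis idem matrix_mul_assoc matrix_mul_lid)
qed

text \<open>The row \<open>y t = x v* \<gamma> t\<close> solves the linear differential equation \<open>y' = k *\<^sub>R y\<close>, because \<open>v\<close> commutes with
\<open>\<gamma> t\<close>: the function \<open>exp (- (k * t)) *\<^sub>R y t\<close> has derivative \<open>0\<close>.\<close>

lemma one_parameter_subgroup_row_eigenvector:
  fixes x :: "complex^2"
  assumes \<gamma>: "one_parameter_subgroup SL2C \<gamma>" and v: "(\<gamma> has_vector_derivative v) (at 0)"
    and x: "x v* v = k *\<^sub>R x"
  shows "x v* \<gamma> t = exp (k * t) *\<^sub>R x"
proof -
  define f where "f t = exp (- (k * t)) *\<^sub>R (x v* \<gamma> t)" for t
  have "(f has_vector_derivative 0) (at t)" for t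
  proof -
    have "((\<lambda>t. x v* \<gamma> t) has_vector_derivative x v* (v ** \<gamma> t)) (at t)"
      by (rule bounded_linear.has_vector_derivative[OF bounded_linear_row_mult
            one_parameter_subgroup_derivative(2)[OF \<gamma> v]])
    also have "x v* (v ** \<gamma> t) = k *\<^sub>R (x v* \<gamma> t)"
      by (simp add: x scaleR_row_mult flip: vector_matrix_mul_assoc)
    finally show ?thesis
      unfolding f_def by (auto intro!: derivative_eq_intros)
  qed
  then have "f t = f 0"
    using has_vector_derivative_zero_constant[of UNIV f] by (metis UNIV_I convex_UNIV)
  then have "exp (- (k * t)) *\<^sub>R (x v* \<gamma> t) = x"
    by (simp add: f_def one_parameter_subgroup_0[OF \<gamma>])
  then have "exp (k * t) *\<^sub>R exp (- (k * t)) *\<^sub>R (x v* \<gamma> t) = exp (k * t) *\<^sub>R x"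
    by simp
  then show ?thesis
    by (simp flip: exp_add)
qed

section \<open>The length of a competitor\<close>

lemma Re_det_derivative:
  fixes g :: "real \<Rightarrow> cmat2"
  assumes g: "(g has_vector_derivative g t ** u) (at t)" and "u \<in> H"
  shows "((\<lambda>s. Re (det (g s))) has_real_derivative coord e0 u * Re (det (g t))) (at t)"
proof -
  obtain a0 a1 a2 a3 where u: "u = a0 *\<^sub>R e0 + a1 *\<^sub>R e1 + a2 *\<^sub>R e2 + a3 *\<^sub>R e3"
    using assms(2) H_iff by blast
  have entry: "((\<lambda>s. g s $ i $ j) has_vector_derivative (g t ** u) $ i $ j) (at t)" for i j
    by (intro bounded_linear.has_vector_derivative[OF bounded_linear_vec_nth]
        bounded_linear.has_vector_derivative[OF bounded_linear_vec_nth] g)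
  have "((\<lambda>s. det (g s)) has_vector_derivative
      g t $ 1 $ 1 * (g t ** u) $ 2 $ 2 + (g t ** u) $ 1 $ 1 * g t $ 2 $ 2
      - (g t $ 1 $ 2 * (g t ** u) $ 2 $ 1 + (g t ** u) $ 1 $ 2 * g t $ 2 $ 1)) (at t)"
    unfolding det_2
    by (intro has_vector_derivative_diff has_vector_derivative_mult entry)
  also have "g t $ 1 $ 1 * (g t ** u) $ 2 $ 2 + (g t ** u) $ 1 $ 1 * g t $ 2 $ 2
      - (g t $ 1 $ 2 * (g t ** u) $ 2 $ 1 + (g t ** u) $ 1 $ 2 * g t $ 2 $ 1)
      = (u $ 1 $ 1 + u $ 2 $ 2) * det (g t)"
    by (simp add: det_2 matrix_matrix_mult_def sum_2 algebra_simps)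
  also have "u $ 1 $ 1 + u $ 2 $ 2 = complex_of_real (coord e0 u)"
    unfolding u coord_combination by (simp add: e_entries complex_eq_iff)
  finally have "((\<lambda>s. Re (det (g s))) has_vector_derivative
      Re (complex_of_real (coord e0 u) * det (g t))) (at t)"
    by (rule bounded_linear.has_vector_derivative[OF bounded_linear_Re])
  then show ?thesis
    by (simp add: has_real_derivative_iff_has_vector_derivative)
qed

lemma row_norm_derivative:
  fixes g :: "real \<Rightarrow> cmat2" and x :: "complex^2"
  assumes g: "(g has_vector_derivative g t ** u) (at t)"
  defines "y \<equiv> \<lambda>s. x v* g s"
  shows "((\<lambda>s. y s \<bullet> y s) has_real_derivative 2 * (y t \<bullet> (y t v* u))) (at t)"
proof -
  have "(y has_vector_derivative y t v* u) (at t)"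
    using bounded_linear.has_vector_derivative[OF bounded_linear_row_mult g, of x]
    by (simp add: y_def vector_matrix_mul_assoc)
  from bounded_bilinear.has_vector_derivative[OF bounded_bilinear_inner this this]
  show ?thesis
    by (simp add: has_real_derivative_iff_has_vector_derivative inner_commute)
qed

lemma row_mult_eq_0_iff:
  fixes x :: "complex^2"
  assumes "A \<in> GLp"
  shows "x v* A = 0 \<longleftrightarrow> x = 0"
proof
  assume *: "x v* A = 0"
  have "det A \<noteq> 0" using assms by (auto simp: GLp_def)
  then obtain A' where "A ** A' = mat 1"
    by (auto simp: invertible_det_nz[symmetric] invertible_def)
  then have "x = (x v* A) v* A'"
    by (simp add: vector_matrix_mul_assoc)
  with * show "x = 0" by simp
qed simp

lemma lipschitz_on_Re_det:
  fixes g :: "real \<Rightarrow> cmat2"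
  assumes "compact S" "L-lipschitz_on S g"
  shows "\<exists>K. K-lipschitz_on S (\<lambda>s. Re (det (g s)))"
proof -
  have entry: "\<exists>K. K-lipschitz_on S (\<lambda>s. g s $ i $ j)" for i j
    using lipschitz_on_bounded_linear_compose[OF bounded_linear_compose[OF
        bounded_linear_vec_nth[of j] bounded_linear_vec_nth[of i]] assms(2)] .
  have prod: "\<exists>K. K-lipschitz_on S (\<lambda>s. g s $ i $ j * g s $ k $ l)" for i j k l
    using entry[of i j] entry[of k l] bounded_bilinear.lipschitz_on_prod[OF bounded_bilinear_mult \<open>compact S\<close>]
    by blast
  obtain K where "K-lipschitz_on S (\<lambda>s. det (g s))"
    unfolding det_2 using prod[of 1 1 2 2] prod[of 1 2 2 1] lipschitz_on_diff by blast
  then show ?thesis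
    by (rule lipschitz_on_bounded_linear_compose[OF bounded_linear_Re])
qed

lemma lipschitz_on_row_norm:
  fixes g :: "real \<Rightarrow> cmat2" and x :: "complex^2"
  assumes "compact S" "L-lipschitz_on S g"
  shows "\<exists>K. K-lipschitz_on S (\<lambda>s. (x v* g s) \<bullet> (x v* g s))"
  using lipschitz_on_bounded_linear_compose[OF bounded_linear_row_mult assms(2), of x]
    bounded_bilinear.lipschitz_on_prod[OF bounded_bilinear_inner \<open>compact S\<close>]
  by blast

text \<open>This is the calibration bound for an arbitrary competitor: only its end points enter, through the
determinant and through the length of the row \<open>x v* g s\<close>. The function \<open>F\<close> below is Lipschitz since \<open>D\<close> and
\<open>N\<close> are bounded away from \<open>0\<close> on the compact interval.\<close>

lemma curve_length_le:
  fixes x :: "complex^2"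
  assumes fd: "future_directed a b g" and ns: "nonspacelike a b g" and "x \<noteq> 0"
    and AB: "A\<^sup>2 - B\<^sup>2 = 1" "0 < A" "0 \<le> B"
  defines "D \<equiv> \<lambda>s. Re (det (g s))" and "N \<equiv> \<lambda>s. (x v* g s) \<bullet> (x v* g s)"
  shows "curve_length a b g \<le> (A + B) * (ln (D b) - ln (D a)) - B * (ln (N b) - ln (N a))"
proof -
  have hc: "horizontal_curve a b g"
    using fd by (simp add: future_directed_def)
  then obtain L where "a < b" and GLp: "\<And>t. t \<in> {a..b} \<Longrightarrow> g t \<in> GLp" and lip: "L-lipschitz_on {a..b} g"
    unfolding horizontal_curve_def image_subset_iff by blast
  have D_pos: "D t > 0" if "t \<in> {a..b}" for t
    using GLp[OF that] by (simp add: D_def GLp_def)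
  have N_pos: "N t > 0" if "t \<in> {a..b}" for t
    using row_mult_eq_0_iff[OF GLp[OF that]] \<open>x \<noteq> 0\<close> by (simp add: N_def)
  define F where "F t = (A + B) * ln (D t) - B * ln (N t)" for t
  obtain K1 where K1: "K1-lipschitz_on {a..b} (\<lambda>t. ln (D t))"
    using lipschitz_on_Re_det[OF _ lip] lipschitz_on_ln[of "{a..b}" _ D] D_pos
    unfolding D_def by blast
  obtain K2 where K2: "K2-lipschitz_on {a..b} (\<lambda>t. ln (N t))"
    using lipschitz_on_row_norm[OF _ lip, of x] lipschitz_on_ln[of "{a..b}" _ N] N_pos
    unfolding N_def by blast
  have F_lip: "(\<bar>A + B\<bar> * K1 + \<bar>B\<bar> * K2)-lipschitz_on {a..b} F"
    unfolding F_def by (intro lipschitz_on_diff lipschitz_on_cmult_real K1 K2)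
  let ?u = "left_velocity g"
  have "AE t in lebesgue. t \<in> {a..b} \<longrightarrow> (g has_vector_derivative g t ** ?u t) (at t) \<and> ?u t \<in> H"
    using hc by (simp add: horizontal_curve_def)
  moreover have "AE t in lebesgue. t \<in> {a..b} \<longrightarrow> pprod (?u t) (?u t) \<ge> 0"
    using ns by (simp add: nonspacelike_def)
  moreover have "AE t in lebesgue. t \<in> {a..b} \<longrightarrow> pprod (?u t) e0 > 0"
    using fd by (simp add: future_directed_def)
  ultimately have "AE t in lebesgue. t \<in> {a..b} \<longrightarrow>
      (\<exists>d. (F has_real_derivative d) (at t) \<and> sqrt (pprod (?u t) (?u t)) \<le> d \<and> 0 \<le> d)"
  proof eventually_elim
    case (elim t)
    show ?case
    proof
      assume t: "t \<in> {a..b}"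
      let ?y = "x v* g t"
      let ?d = "(A + B) * coord e0 (?u t) - B * (2 * (?y \<bullet> (?y v* ?u t)) / (?y \<bullet> ?y))"
      have u: "(g has_vector_derivative g t ** ?u t) (at t)" "?u t \<in> H"
          "pprod (?u t) (?u t) \<ge> 0" "pprod (?u t) e0 > 0"
        using elim t by auto
      have "(D has_real_derivative coord e0 (?u t) * D t) (at t)"
        unfolding D_def by (rule Re_det_derivative[OF u(1,2)])
      moreover have "(N has_real_derivative 2 * (?y \<bullet> (?y v* ?u t))) (at t)"
        unfolding N_def by (rule row_norm_derivative[OF u(1)])
      ultimately have "(F has_real_derivative
          (A + B) * (coord e0 (?u t) * D t / D t) - B * (2 * (?y \<bullet> (?y v* ?u t)) / N t)) (at t)"
        unfolding F_def using D_pos[OF t] N_pos[OF t]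
        by (auto intro!: derivative_eq_intros)
      then have "(F has_real_derivative ?d) (at t)"
        using D_pos[OF t] by (simp add: N_def)
      moreover have "sqrt (pprod (?u t) (?u t)) \<le> ?d"
        using N_pos[OF t] by (intro pprod_calibration u(2-4) AB) (auto simp: N_def)
      moreover have "0 \<le> sqrt (pprod (?u t) (?u t))"
        using u(3) by simp
      ultimately show "\<exists>d. (F has_real_derivative d) (at t) \<and>
          sqrt (pprod (?u t) (?u t)) \<le> d \<and> 0 \<le> d"
        using order_trans by blast
    qed
  qed
  from lipschitz_integral_le_increment[OF \<open>a < b\<close> F_lip this] show ?thesis
    by (simp add: curve_length_def F_def algebra_simps)
qed

section \<open>Optimality of the one-parameter subgroups\<close>

theorem theorem9:
  fixes \<gamma> \<sigma> :: "real \<Rightarrow> complex^2^2" and v :: "complex^2^2"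
  defines "\<sigma> \<equiv> \<lambda>t. exp (t / 2) *\<^sub>R \<gamma> t"
  assumes "one_parameter_subgroup SL2C \<gamma>"
    and "(\<gamma> has_vector_derivative v) (at 0)" and "v \<in> H0"
    and "\<And>a b. a < b \<Longrightarrow> future_directed a b \<sigma> \<and> nonspacelike a b \<sigma>"
  shows "(\<forall>a b. a < b \<longrightarrow> longest_arc a b \<sigma>) \<and>
    ((\<forall>a b. a < b \<longrightarrow> timelike a b \<sigma>) \<longrightarrow>
     (\<forall>a b. a < b \<longrightarrow> proportional_to_arclength a b \<sigma>))"
proof -
  note \<gamma> = assms(2) and v = assms(3,4) and \<sigma>_curve = assms(5)
  define r where "r = sqrt (- pprod v v)"
  have "r \<ge> 0" and r_sq: "r\<^sup>2 = - pprod v v"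
    using pprod_e0_plus_H0(3)[OF v(2)] by (simp_all add: r_def)
  have \<sigma>_GLp: "\<sigma> t \<in> GLp" and \<sigma>_det: "Re (det (\<sigma> t)) = exp t" for t
  proof -
    have "det (\<gamma> t) = 1"
      using \<gamma> by (auto simp: one_parameter_subgroup_def SL2C_def)
    moreover have "det (\<sigma> t) = (exp (t / 2) * exp (t / 2)) *\<^sub>R det (\<gamma> t)"
      by (simp add: \<sigma>_def det_2 scaleR_diff_right)
    ultimately have "det (\<sigma> t) = complex_of_real (exp t)"
      by (simp add: scaleR_conv_of_real flip: exp_add)
    then show "\<sigma> t \<in> GLp" "Re (det (\<sigma> t)) = exp t"
      by (simp_all add: GLp_def)
  qed
  have \<sigma>_velocity: "left_velocity \<sigma> t = e0 + v" for t
  proof (rule left_velocity_eq[OF _ \<sigma>_GLp])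
    have "(\<sigma> has_vector_derivative
        exp (t / 2) *\<^sub>R (\<gamma> t ** v) + (exp (t / 2) / 2) *\<^sub>R \<gamma> t) (at t)"
      unfolding \<sigma>_def
      by (rule has_vector_derivative_scaleR)
         (auto intro!: derivative_eq_intros one_parameter_subgroup_derivative(1)[OF \<gamma> v(1)])
    also have "exp (t / 2) *\<^sub>R (\<gamma> t ** v) + (exp (t / 2) / 2) *\<^sub>R \<gamma> t = \<sigma> t ** (e0 + v)"
      by (simp add: \<sigma>_def vec_eq_iff forall_2 matrix_matrix_mult_def sum_2 e_entries
          complex_eq_iff algebra_simps)
    finally show "(\<sigma> has_vector_derivative \<sigma> t ** (e0 + v)) (at t)" .
  qed
  have \<sigma>_pprod: "pprod (left_velocity \<sigma> t) (left_velocity \<sigma> t) = 1 - r\<^sup>2" for t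
    by (simp add: \<sigma>_velocity pprod_e0_plus_H0(2)[OF v(2)] r_sq)
  have \<sigma>_length: "curve_length a b \<sigma> = sqrt (1 - r\<^sup>2) * (b - a)" if "a \<le> b" for a b
    using that by (simp add: curve_length_def \<sigma>_pprod set_lebesgue_integral_def)
  \<comment> \<open>The curve conditions hold only almost everywhere, but \<open>{0..1}\<close> is not a null set.\<close>
  have ex_velocity: "\<exists>t. Q (left_velocity \<sigma> t)"
    if "AE t in lebesgue. t \<in> {0..1::real} \<longrightarrow> Q (left_velocity \<sigma> t)" for Q
  proof (rule ccontr)
    assume "\<not> ?thesis"
    then have "AE t in lebesgue. t \<notin> {0..1::real}" using that by simp
    then have "emeasure lebesgue {0..1::real} = 0"
      by (subst (asm) AE_iff_measurable[of "{0..1}"]) auto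
    then show False by simp
  qed
  have "r\<^sup>2 \<le> 1"
    using ex_velocity[of "\<lambda>u. pprod u u \<ge> 0"] \<sigma>_curve[of 0 1]
    by (simp add: nonspacelike_def \<sigma>_pprod)
  then have "r \<le> 1" using \<open>r \<ge> 0\<close> by (simp add: power_le_one_iff abs_square_le_1)
  obtain x where "x \<noteq> 0" and "x v* v = (r / 2) *\<^sub>R x"
    using H0_row_eigenvector[OF v(2)] by (auto simp: r_def)
  from one_parameter_subgroup_row_eigenvector[OF \<gamma> v(1) this(2)]
  have \<sigma>_row: "x v* \<sigma> t = exp ((1 + r) / 2 * t) *\<^sub>R x" for t
  proof -
    have "x v* \<sigma> t = exp (t / 2) *\<^sub>R (x v* \<gamma> t)"
      unfolding \<sigma>_def by (rule linear_cmul[OF bounded_linear.linear[OF bounded_linear_row_mult]])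
    then show ?thesis
      using \<open>\<And>t. x v* \<gamma> t = _\<close> by (simp add: algebra_simps add_divide_distrib flip: exp_add)
  qed
  have \<sigma>_row_norm: "ln ((x v* \<sigma> t) \<bullet> (x v* \<sigma> t)) = (1 + r) * t + ln (x \<bullet> x)" for t
  proof -
    have "(x v* \<sigma> t) \<bullet> (x v* \<sigma> t) = exp ((1 + r) * t) * (x \<bullet> x)"
      by (simp add: \<sigma>_row mult.assoc[symmetric] flip: exp_add)
    then show ?thesis using \<open>x \<noteq> 0\<close> by (simp add: ln_mult)
  qed
  have bound: "curve_length a' b' g \<le> (A - B * r) * (b - a)"
    if g: "future_directed a' b' g" "nonspacelike a' b' g" "g a' = \<sigma> a" "g b' = \<sigma> b"
      and AB: "A\<^sup>2 - B\<^sup>2 = 1" "0 < A" "0 \<le> B" for a b a' b' g A B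
  proof -
    have "curve_length a' b' g \<le> (A + B) * (b - a) - B * ((1 + r) * b - (1 + r) * a)"
      using curve_length_le[OF g(1,2) \<open>x \<noteq> 0\<close> AB] by (simp add: g(3,4) \<sigma>_det \<sigma>_row_norm)
    then show ?thesis by (simp add: algebra_simps)
  qed
  have competitor: "curve_length a' b' g \<le> sqrt (1 - r\<^sup>2) * (b - a)"
    if g: "future_directed a' b' g" "nonspacelike a' b' g" "g a' = \<sigma> a" "g b' = \<sigma> b"
    for a b a' b' g
  proof (cases "r < 1")
    case True
    \<comment> \<open>The point \<open>(1 / w, r / w)\<close> of the hyperbola is the direction of \<open>e0 + v\<close>, where the bound is attained.\<close>
    define w where "w = sqrt (1 - r\<^sup>2)"
    have "r\<^sup>2 < 1" using True \<open>r \<ge> 0\<close> by (simp add: power_less_one_iff abs_square_less_1)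
    then have w: "w > 0" "w\<^sup>2 = 1 - r\<^sup>2" by (simp_all add: w_def)
    have "(1 / w)\<^sup>2 - (r / w)\<^sup>2 = 1"
      using w \<open>r\<^sup>2 < 1\<close> by (simp add: power_divide diff_divide_distrib[symmetric])
    moreover have "1 / w - r / w * r = w"
      using w by (simp add: field_simps power2_eq_square)
    ultimately show ?thesis
      using bound[OF g, of "1 / w" "r / w"] w(1) \<open>r \<ge> 0\<close> by (simp add: w_def)
  next
    case False
    with \<open>r \<le> 1\<close> have "r = 1" by simp
    \<comment> \<open>No point of the hyperbola has a null direction; such a direction is approached by letting the rapidity \<open>\<theta>\<close> tend to infinity.\<close>
    have "((\<lambda>\<theta>. exp (- \<theta>) * (b - a)) \<longlongrightarrow> 0 * (b - a)) at_top"
      by (intro tendsto_mult tendsto_const filterlim_compose[OF exp_at_bot filterlim_uminus_at_bot_at_top])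
    moreover have "curve_length a' b' g \<le> exp (- \<theta>) * (b - a)" if "\<theta> \<ge> 0" for \<theta>
    proof -
      have "curve_length a' b' g \<le> (cosh \<theta> - sinh \<theta> * r) * (b - a)"
        using that by (intro bound[OF g]) (simp_all add: cosh_square_eq)
      then show ?thesis by (simp add: \<open>r = 1\<close> cosh_minus_sinh)
    qed
    then have "\<forall>\<^sub>F \<theta> in at_top. curve_length a' b' g \<le> exp (- \<theta>) * (b - a)"
      by (rule eventually_at_top_linorderI)
    ultimately have "curve_length a' b' g \<le> 0 * (b - a)"
      by (rule tendsto_lowerbound) simp
    then show ?thesis by (simp add: \<open>r = 1\<close>)
  qed
  have "longest_arc a b \<sigma>" if "a < b" for a b
  proof -
    note curve = conjunct1[OF \<sigma>_curve[OF that]] conjunct2[OF \<sigma>_curve[OF that]]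
    have "lorentz_dist (\<sigma> a) (\<sigma> b) = ereal (curve_length a b \<sigma>)"
      unfolding lorentz_dist_def
    proof (rule antisym)
      show "Sup {ereal (curve_length a' b' g) |a' b' g. future_directed a' b' g \<and>
          nonspacelike a' b' g \<and> g a' = \<sigma> a \<and> g b' = \<sigma> b} \<le> ereal (curve_length a b \<sigma>)"
        using competitor \<sigma>_length[of a b] that by (auto intro!: Sup_least)
      show "ereal (curve_length a b \<sigma>) \<le> Sup {ereal (curve_length a' b' g) |a' b' g.
          future_directed a' b' g \<and> nonspacelike a' b' g \<and> g a' = \<sigma> a \<and> g b' = \<sigma> b}"
        using curve by (intro Sup_upper) blast
    qed
    then show ?thesis
      using curve by (simp add: longest_arc_def)
  qed
  moreover have "proportional_to_arclength a b \<sigma>" if "\<forall>a b. a < b \<longrightarrow> timelike a b \<sigma>" for a b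
  proof -
    have "r\<^sup>2 < 1"
      using ex_velocity[of "\<lambda>u. pprod u u > 0"] that[rule_format, of 0 1]
      by (simp add: timelike_def \<sigma>_pprod)
    then show ?thesis
      unfolding proportional_to_arclength_def
      by (intro exI[of _ "sqrt (1 - r\<^sup>2)"]) (simp add: \<sigma>_length)
  qed
  ultimately show ?thesis by blast
qed

end
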